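(* Let $k\ge 1$ be an integer. (1) If $a=T_k$, then the set $\{T_1,T_{k+1}\}$ is a $D(a)$-pair of triangular numbers. (2) If $k\geq 2$ and $a=1-T_k$, then the set $\{T_2,T_{k+1}\}$ is a $D(a)$-pair of triangular numbers.
   Context: For a positive integer $n$, $T_n=\frac{n(n+1)}{2}$ denotes the $n$-th triangular number. For a non-zero integer $a$, a $D(a)$-pair is a set of two distinct positive integers whose product increased by $a$ is a perfect square. *)

theory Defs
  imports Main "HOL-Library.Nat_Bijection" "HOL-Computational_Algebra.Nth_Powers"
begin

text \<open>
  The \<open>n\<close>-th triangular number \<open>n(n+1)/2\<close> is \<^const>\<open>triangle\<close> \<open>n\<close>. Only positive indices count, so
  \<open>triangle 0 = 0\<close> is excluded.
\<close>

definition triangular_numbers :: "nat set" where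
  "triangular_numbers = triangle ` {1..}"

text \<open>
  The parameter \<open>a\<close> may be negative, so the square condition is stated over the integers.
\<close>

definition D_pair :: "int \<Rightarrow> nat set \<Rightarrow> bool" where
  "D_pair a S \<longleftrightarrow> a \<noteq> 0 \<and>
     (\<exists>x y. S = {x, y} \<and> x \<noteq> y \<and> x > 0 \<and> y > 0 \<and> is_square (int x * int y + a))"

definition D_pair_of_triangular_numbers :: "int \<Rightarrow> nat set \<Rightarrow> bool" where
  "D_pair_of_triangular_numbers a S \<longleftrightarrow> D_pair a S \<and> S \<subseteq> triangular_numbers"

end

theory Submission
  imports Defs
begin

text \<open>
  Both parts rest on writing the product plus \<open>a\<close> as a square by means of two facts about
  consecutive triangular numbers: they differ by \<open>k + 1\<close> and sum to \<open>(k + 1)\<^sup>2\<close>.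
  As \<open>T\<^sub>1 = 1\<close>, the first part is \<open>T\<^bsub>k+1\<^esub> + T\<^sub>k = (k + 1)\<^sup>2\<close> itself.
  As \<open>T\<^sub>2 = 3\<close>, the second part follows from
  \<open>3 T\<^bsub>k+1\<^esub> + 1 - T\<^sub>k = (T\<^bsub>k+1\<^esub> + T\<^sub>k) + 2 (T\<^bsub>k+1\<^esub> - T\<^sub>k) + 1 = (k + 1)\<^sup>2 + 2 (k + 1) + 1 = (k + 2)\<^sup>2\<close>.
  Strict monotonicity of the triangular numbers makes the two elements distinct and, in the
  second part, gives \<open>a < 0\<close>; there \<open>k = 1\<close> would give \<open>a = 0\<close>.
\<close>

lemma strict_mono_triangle: "strict_mono triangle"
  by (simp add: strict_mono_Suc_iff)

lemma triangle_add_triangle_Suc: "triangle k + triangle (Suc k) = (Suc k)\<^sup>2"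
  by (induction k) (simp_all add: power2_eq_square)

lemma three_triangle_Suc_diff_triangle:
  "3 * int (triangle (Suc k)) + (1 - int (triangle k)) = (int k + 2)\<^sup>2"
proof -
  have "int (triangle k) + int (triangle (Suc k)) = (int k + 1)\<^sup>2"
    using arg_cong[OF triangle_add_triangle_Suc, of int k] by (simp add: add.commute)
  moreover have "int (triangle (Suc k)) - int (triangle k) = int k + 1"
    by simp
  ultimately show ?thesis
    by (simp add: power2_eq_square algebra_simps)
qed

lemma D_pair_of_triangular_numbersI:
  assumes "a \<noteq> 0" "0 < m" "m < n"
    and square: "int (triangle m) * int (triangle n) + a = c\<^sup>2"
  shows "D_pair_of_triangular_numbers a {triangle m, triangle n}"
proof -
  have "triangle 0 < triangle m" "triangle m < triangle n"
    using assms(2,3) strict_mono_triangle by (simp_all only: strict_mono_less)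
  moreover have "is_square (int (triangle m) * int (triangle n) + a)"
    unfolding square by simp
  ultimately have "D_pair a {triangle m, triangle n}"
    unfolding D_pair_def using \<open>a \<noteq> 0\<close>
    by (intro conjI exI[of _ "triangle m"] exI[of _ "triangle n"]) auto
  then show ?thesis
    using assms(2,3)
    by (auto simp: D_pair_of_triangular_numbers_def triangular_numbers_def)
qed

theorem proposition8:
  fixes k :: nat and a :: int
  assumes "k \<ge> 1"
  shows "(a = int (triangle k) \<longrightarrow>
            D_pair_of_triangular_numbers a {triangle 1, triangle (k + 1)}) \<and>
         (k \<ge> 2 \<and> a = 1 - int (triangle k) \<longrightarrow>
            D_pair_of_triangular_numbers a {triangle 2, triangle (k + 1)})"
proof (intro conjI impI)
  assume a: "a = int (triangle k)"
  have "triangle 0 < triangle k"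
    using assms by (intro strict_monoD[OF strict_mono_triangle]) simp
  moreover have "int (triangle 1) * int (triangle (k + 1)) + a = (int (Suc k))\<^sup>2"
    using arg_cong[OF triangle_add_triangle_Suc, of int k] by (simp add: a)
  ultimately show "D_pair_of_triangular_numbers a {triangle 1, triangle (k + 1)}"
    using assms a by (intro D_pair_of_triangular_numbersI) auto
next
  assume k: "k \<ge> 2 \<and> a = 1 - int (triangle k)"
  then have "triangle 1 < triangle k"
    by (intro strict_monoD[OF strict_mono_triangle]) simp
  moreover have "int (triangle 2) * int (triangle (k + 1)) + a = (int k + 2)\<^sup>2"
    using three_triangle_Suc_diff_triangle[of k] k by (simp add: numeral_2_eq_2)
  ultimately show "D_pair_of_triangular_numbers a {triangle 2, triangle (k + 1)}"
    using k by (intro D_pair_of_triangular_numbersI) auto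
qed

end
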